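(* Let $0<q<p$, let $n\ge1$ be an integer, and let $f$ be a function for which the $(p,q)$-Laplace transform of the first kind exists. Then, for $s>0$, $$L_{p,q}\{D_{p,q}^nf(t)\}(s)=\frac{s^n}{p^{\binom{n+1}2}}\,L_{p,q}\{f(t)\}\!\left(\frac s{p^n}\right)-\sum_{k=0}^{n-1}\frac{s^{n-1-k}}{p^{\binom{n-k}2}}\,(D_{p,q}^kf)(0).$$
   Context: Let $0<q<p$ be real numbers. For an integer $n\ge 0$, $[n]_{p,q}=\frac{p^n-q^n}{p-q}$, $[n]_{p,q}!=\prod_{k=1}^n[k]_{p,q}$ for $n\ge1$, $[0]_{p,q}!=1$. The big $(p,q)$-exponential is $E_{p,q}(z)=\sum_{n=0}^\infty\frac{q^{\binom n2}}{[n]_{p,q}!}z^n$. The $(p,q)$-derivative of $f$ is $D_{p,q}f(x)=\frac{f(px)-f(qx)}{(p-q)x}$ for $x\ne0$, and $(D_{p,q}f)(0)=f'(0)$ provided that $f$ is differentiable at $0$; $D_{p,q}^k$ is its $k$-fold iterate, with $D_{p,q}^0f=f$. The improper $(p,q)$-integral of $f$ on $[0,\infty)$ is $\int_0^\infty f(x)\,d_{p,q}x=(p-q)\sum_{j=-\infty}^{\infty}\frac{q^j}{p^{j+1}}f\!\left(\frac{q^j}{p^{j+1}}\right)$. The $(p,q)$-Laplace transform of the first kind of a function $f(t)$ is $L_{p,q}\{f(t)\}(s)=\int_0^\infty f(t)E_{p,q}(-qts)\,d_{p,q}t$, $s>0$.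
   Formalization: The claim fails for general 0<q<p; the formal version adds that L{f(p^n t)}(s) exists and equals p^{-n}L{f}(s/p^n) (automatic if p^n is an integer power of q/p), and that D^k f is differentiable at 0 for k<n; existence of L{f} is asked only at s/p^n. *)

theory Defs
  imports "HOL-Analysis.Analysis"
begin

definition pq_number :: "real \<Rightarrow> real \<Rightarrow> nat \<Rightarrow> real" where
  "pq_number p q n = (p ^ n - q ^ n) / (p - q)"

definition pq_fact :: "real \<Rightarrow> real \<Rightarrow> nat \<Rightarrow> real" where
  "pq_fact p q n = (\<Prod>k=1..n. pq_number p q k)"

definition pq_Exp :: "real \<Rightarrow> real \<Rightarrow> real \<Rightarrow> real" where
  "pq_Exp p q z = (\<Sum>n. q ^ (n choose 2) / pq_fact p q n * z ^ n)"

definition pq_deriv :: "real \<Rightarrow> real \<Rightarrow> (real \<Rightarrow> real) \<Rightarrow> real \<Rightarrow> real" where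
  "pq_deriv p q f x =
     (if x = 0 then deriv f 0 else (f (p * x) - f (q * x)) / ((p - q) * x))"

definition pq_node :: "real \<Rightarrow> real \<Rightarrow> int \<Rightarrow> real" where
  "pq_node p q j = q powi j / p powi (j + 1)"

text \<open>A bilateral series converges if its two halves, over \<open>j \<ge> 0\<close> and over \<open>j < 0\<close>, both
  converge; conditional convergence is allowed.

  The node set is invariant under \<open>t \<mapsto> (q/p) t\<close>, but under \<open>t \<mapsto> a t\<close> only if \<open>a\<close> is an
  integer power of \<open>q/p\<close>. So the substitution rule \<open>\<integral> g(a t) dt = (1/a) \<integral> g(t) dt\<close> is
  a genuine condition on \<open>g\<close>, already for \<open>a = p\<close>, unless \<open>a\<close> is such a power.\<close>

definition pq_integrable :: "real \<Rightarrow> real \<Rightarrow> (real \<Rightarrow> real) \<Rightarrow> bool" where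
  "pq_integrable p q f \<longleftrightarrow>
     summable (\<lambda>i. pq_node p q (int i) * f (pq_node p q (int i))) \<and>
     summable (\<lambda>i. pq_node p q (- int (Suc i)) * f (pq_node p q (- int (Suc i))))"

definition pq_integral :: "real \<Rightarrow> real \<Rightarrow> (real \<Rightarrow> real) \<Rightarrow> real" where
  "pq_integral p q f = (p - q) *
     ((\<Sum>i. pq_node p q (int i) * f (pq_node p q (int i))) +
      (\<Sum>i. pq_node p q (- int (Suc i)) * f (pq_node p q (- int (Suc i)))))"

definition pq_laplace_exists :: "real \<Rightarrow> real \<Rightarrow> (real \<Rightarrow> real) \<Rightarrow> real \<Rightarrow> bool" where
  "pq_laplace_exists p q f s \<longleftrightarrow> pq_integrable p q (\<lambda>t. f t * pq_Exp p q (- q * t * s))"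

definition pq_laplace :: "real \<Rightarrow> real \<Rightarrow> (real \<Rightarrow> real) \<Rightarrow> real \<Rightarrow> real" where
  "pq_laplace p q f s = pq_integral p q (\<lambda>t. f t * pq_Exp p q (- q * t * s))"

end

theory Submission
  imports Defs
begin

text \<open>Put \<open>h(x) = g(x) E(-s x)\<close>. The functional equation \<open>E(p z) = (1 + (p - q) z) E(q z)\<close>
  turns the summand of \<open>L{D g}(s)\<close> at a node \<open>t\<close> into the difference \<open>h(p t) - h(q t)\<close> plus \<open>s\<close>
  times the summand of \<open>L{g(p \<cdot>)}(s)\<close>. Since \<open>q t\<close> is \<open>p\<close> times the next node, the differences
  telescope; \<open>h\<close> tends to \<open>g(0)\<close> along the nodes going to \<open>0\<close>, and it tends to \<open>0\<close> along those
  going to infinity because the summands of the convergent series for \<open>L{g(p \<cdot>)}(s)\<close> do.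
  Hence \<open>L{D g}(s) = s L{g(p \<cdot>)}(s) - g(0)\<close>, and the theorem follows by induction on \<open>n\<close>, since
  \<open>(D\<^sup>n f)(p \<cdot>) = p\<^sup>-\<^sup>n D\<^sup>n (f(p \<cdot>))\<close>.\<close>

section \<open>The \<open>(p,q)\<close>-exponential: convergence and functional equation\<close>

lemma pq_number_ge:
  assumes "0 < q" "q < p"
  shows "p ^ n \<le> pq_number p q (Suc n)"
proof -
  have "q ^ n * q \<le> p ^ n * q"
    using assms by (intro mult_right_mono power_mono) auto
  then show ?thesis
    using assms by (simp add: pq_number_def field_simps)
qed

lemma pq_fact_Suc: "pq_fact p q (Suc n) = pq_fact p q n * pq_number p q (Suc n)"
  by (simp add: pq_fact_def)

lemma pq_fact_pos:
  assumes "0 < q" "q < p"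
  shows "0 < pq_fact p q n"
  unfolding pq_fact_def
  using assms by (intro prod_pos) (auto simp: pq_number_def power_strict_mono)

lemma choose_Suc_two: "Suc n choose 2 = (n choose 2) + n"
  by (simp add: numeral_2_eq_2)

text \<open>Kept in product form so that it serves both the ratio test and the comparison of
  coefficients in the functional equation.\<close>

lemma pq_Exp_coeff_Suc:
  assumes "0 < q" "q < p"
  shows "q ^ (Suc n choose 2) / pq_fact p q (Suc n) * pq_number p q (Suc n) =
    q ^ (n choose 2) / pq_fact p q n * q ^ n"
proof -
  have "0 < pq_number p q (Suc n)"
    using pq_number_ge[OF assms, of n] assms by (smt (verit) zero_less_power)
  then show ?thesis
    by (simp add: pq_fact_Suc choose_Suc_two power_add)
qed

text \<open>Consecutive coefficients have ratio \<open>q ^ n / pq_number p q (Suc n)\<close>, at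
  most \<open>(q / p) ^ n\<close> by \<open>pq_number_ge\<close>. This tends to 0, so the ratio test
  applies for every \<open>z\<close>.\<close>

lemma summable_pq_Exp:
  assumes "0 < q" "q < p"
  shows "summable (\<lambda>n. q ^ (n choose 2) / pq_fact p q n * z ^ n)"
proof -
  define c where "c = (\<lambda>n. q ^ (n choose 2) / pq_fact p q n)"
  have "(\<lambda>n. (q / p) ^ n * \<bar>z\<bar>) \<longlonglongrightarrow> 0 * \<bar>z\<bar>"
    using assms by (intro tendsto_intros LIMSEQ_power_zero) auto
  then have "eventually (\<lambda>n. (q / p) ^ n * \<bar>z\<bar> < 1 / 2) sequentially"
    by (rule order_tendstoD) simp
  then obtain N where N: "\<And>n. n \<ge> N \<Longrightarrow> (q / p) ^ n * \<bar>z\<bar> < 1 / 2"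
    by (auto simp: eventually_sequentially)
  have c_pos: "0 < c n" for n
    using assms pq_fact_pos[OF assms] by (simp add: c_def)
  have c_le: "c (Suc n) \<le> c n * (q / p) ^ n" for n
  proof -
    have "c (Suc n) * p ^ n \<le> c (Suc n) * pq_number p q (Suc n)"
      using pq_number_ge[OF assms] c_pos by (intro mult_left_mono) (auto simp: less_imp_le)
    also have "\<dots> = c n * q ^ n"
      using pq_Exp_coeff_Suc[OF assms] by (simp add: c_def)
    finally show ?thesis
      using assms by (simp add: power_divide pos_le_divide_eq)
  qed
  have "summable (\<lambda>n. c n * z ^ n)"
  proof (rule summable_ratio_test)
    fix n assume n: "n \<ge> N"
    have "norm (c (Suc n) * z ^ Suc n) = c (Suc n) * (\<bar>z\<bar> * \<bar>z\<bar> ^ n)"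
      using c_pos[of "Suc n"] by (simp add: abs_mult power_abs)
    also have "\<dots> \<le> (c n * (q / p) ^ n) * (\<bar>z\<bar> * \<bar>z\<bar> ^ n)"
      using c_le by (intro mult_right_mono) auto
    also have "\<dots> = ((q / p) ^ n * \<bar>z\<bar>) * (c n * \<bar>z\<bar> ^ n)"
      by simp
    also have "\<dots> \<le> 1 / 2 * (c n * \<bar>z\<bar> ^ n)"
      using N[OF n] c_pos[of n] by (intro mult_right_mono) auto
    also have "\<dots> = 1 / 2 * norm (c n * z ^ n)"
      using c_pos[of n] by (simp add: abs_mult power_abs)
    finally show "norm (c (Suc n) * z ^ Suc n) \<le> 1 / 2 * norm (c n * z ^ n)" .
  qed simp
  then show ?thesis
    by (simp add: c_def)
qed

lemma isCont_pq_Exp: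
  assumes "0 < q" "q < p"
  shows "isCont (pq_Exp p q) z"
  unfolding pq_Exp_def
  by (intro isCont_powser_converges_everywhere summable_pq_Exp assms)

lemma pq_Exp_0: "pq_Exp p q 0 = 1"
  using powser_zero[of "\<lambda>n. q ^ (n choose 2) / pq_fact p q n"]
  by (simp add: pq_Exp_def pq_fact_def numeral_2_eq_2)

text \<open>The factor \<open>p ^ Suc n - q ^ Suc n\<close> in the difference of the two series
  cancels the last factor of the factorial, which leaves the series at \<open>q * z\<close> shifted
  by one index.\<close>

lemma pq_Exp_functional_eq:
  assumes "0 < q" "q < p"
  shows "pq_Exp p q (p * z) = (1 + (p - q) * z) * pq_Exp p q (q * z)"
proof -
  define c where "c = (\<lambda>n. q ^ (n choose 2) / pq_fact p q n)"
  have sums: "(\<lambda>n. c n * w ^ n) sums pq_Exp p q w" for w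
    using summable_sums[OF summable_pq_Exp[OF assms]] by (simp add: c_def pq_Exp_def)
  have step: "c (Suc n) * (p * z) ^ Suc n - c (Suc n) * (q * z) ^ Suc n =
      (p - q) * z * (c n * (q * z) ^ n)" for n
  proof -
    have "p ^ Suc n - q ^ Suc n = (p - q) * pq_number p q (Suc n)"
      using assms by (simp add: pq_number_def)
    moreover have "c (Suc n) * (p * z) ^ Suc n - c (Suc n) * (q * z) ^ Suc n =
        c (Suc n) * (p ^ Suc n - q ^ Suc n) * z ^ Suc n"
      by (simp add: power_mult_distrib algebra_simps)
    ultimately have "c (Suc n) * (p * z) ^ Suc n - c (Suc n) * (q * z) ^ Suc n =
        (p - q) * (c (Suc n) * pq_number p q (Suc n)) * z ^ Suc n"
      by simp
    also have "c (Suc n) * pq_number p q (Suc n) = c n * q ^ n"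
      using pq_Exp_coeff_Suc[OF assms] by (simp add: c_def)
    finally show ?thesis
      by (simp add: power_mult_distrib)
  qed
  have "(\<lambda>n. c n * (p * z) ^ n - c n * (q * z) ^ n) sums (pq_Exp p q (p * z) - pq_Exp p q (q * z))"
    by (intro sums_diff sums)
  \<comment> \<open>The constant terms cancel, so dropping index 0 does not change the sum.\<close>
  then have "(\<lambda>n. c (Suc n) * (p * z) ^ Suc n - c (Suc n) * (q * z) ^ Suc n)
      sums (pq_Exp p q (p * z) - pq_Exp p q (q * z))"
    by (subst sums_Suc_iff) simp
  then have "(\<lambda>n. (p - q) * z * (c n * (q * z) ^ n))
      sums (pq_Exp p q (p * z) - pq_Exp p q (q * z))"
    by (simp only: step)
  moreover have "(\<lambda>n. (p - q) * z * (c n * (q * z) ^ n)) sums ((p - q) * z * pq_Exp p q (q * z))"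
    by (intro sums_mult sums)
  ultimately have "pq_Exp p q (p * z) - pq_Exp p q (q * z) = (p - q) * z * pq_Exp p q (q * z)"
    by (rule sums_unique2)
  then show ?thesis
    by (simp add: algebra_simps)
qed

section \<open>Nodes and bilateral sums\<close>

lemma pq_node_pos:
  assumes "0 < q" "q < p"
  shows "0 < pq_node p q j"
  using assms by (simp add: pq_node_def)

lemma pq_node_shift:
  assumes "0 < q" "q < p"
  shows "q * pq_node p q j = p * pq_node p q (j + 1)"
  using assms by (simp add: pq_node_def power_int_add power2_eq_square mult.commute)

lemma pq_node_of_nat:
  assumes "0 < q" "q < p"
  shows "pq_node p q (int i) = (q / p) ^ i / p"
  using assms by (simp add: pq_node_def power_int_add power_divide)

lemma pq_node_minus_of_nat:
  assumes "0 < q" "q < p"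
  shows "pq_node p q (- int i) = (p / q) ^ i / p"
  using assms by (simp add: pq_node_def power_int_diff power_int_minus power_divide field_simps)

lemma pq_integral_sumsI:
  assumes "(\<lambda>i. pq_node p q (int i) * f (pq_node p q (int i))) sums a"
    and "(\<lambda>i. pq_node p q (- int (Suc i)) * f (pq_node p q (- int (Suc i)))) sums b"
  shows "pq_integrable p q f" "pq_integral p q f = (p - q) * (a + b)"
  using assms by (auto simp: pq_integrable_def pq_integral_def sums_iff)

lemma pq_integrable_sumsE:
  assumes "pq_integrable p q f"
  obtains a b where "(\<lambda>i. pq_node p q (int i) * f (pq_node p q (int i))) sums a"
    and "(\<lambda>i. pq_node p q (- int (Suc i)) * f (pq_node p q (- int (Suc i)))) sums b"
    and "pq_integral p q f = (p - q) * (a + b)"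
  using assms by (auto simp: pq_integrable_def pq_integral_def sums_iff)

section \<open>The transform of a single derivative\<close>

lemma pq_laplace_pq_deriv:
  assumes pq: "0 < q" "q < p" and cont: "isCont g 0"
    and ex: "pq_laplace_exists p q (\<lambda>t. g (p * t)) s"
  shows "pq_laplace_exists p q (pq_deriv p q g) s"
    and "pq_laplace p q (pq_deriv p q g) s = s * pq_laplace p q (\<lambda>t. g (p * t)) s - g 0"
proof -
  define t where "t = pq_node p q"
  \<comment> \<open>\<open>u\<close> and \<open>v\<close> are the summands of the two transforms;
    \<open>h j\<close> is the telescoping function evaluated at \<open>p * t j\<close>.\<close>
  define u where "u = (\<lambda>j. t j * (g (p * t j) * pq_Exp p q (- q * t j * s)))"
  define v where "v = (\<lambda>j. t j * (pq_deriv p q g (t j) * pq_Exp p q (- q * t j * s)))"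
  define h where "h = (\<lambda>j. g (p * t j) * pq_Exp p q (- (p * t j * s)))"
  have t_pos: "t j > 0" for j
    using pq_node_pos[OF pq] by (simp add: t_def)
  \<comment> \<open>The functional equation at \<open>- (t j * s)\<close> expresses \<open>h\<close>
    through \<open>u\<close> alone, so decay of \<open>u\<close> will force decay of
    \<open>h\<close>.\<close>
  have h_u: "h j = u j / t j - (p - q) * s * u j" for j
  proof -
    have "h j = g (p * t j) * ((1 + (p - q) * - (t j * s)) * pq_Exp p q (- q * t j * s))"
      using pq_Exp_functional_eq[OF pq, of "- (t j * s)"] by (simp add: h_def mult.assoc)
    then show ?thesis
      using t_pos[of j] by (simp add: u_def algebra_simps)
  qed
  have v_eq: "v j = (h j - h (j + 1)) / (p - q) + s * u j" for j
  proof -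
    have shift: "p * t (j + 1) = q * t j"
      using pq_node_shift[OF pq] by (simp add: t_def)
    \<comment> \<open>Nodes are positive, so \<open>pq_deriv\<close> is the difference quotient
      here.\<close>
    have "(p - q) * v j = (g (p * t j) - g (q * t j)) * pq_Exp p q (- q * t j * s)"
      using t_pos[of j] pq by (simp add: v_def pq_deriv_def)
    also have "\<dots> = u j / t j - h (j + 1)"
      using t_pos[of j] unfolding h_def u_def shift by (simp add: algebra_simps)
    also have "\<dots> = h j - h (j + 1) + (p - q) * (s * u j)"
      by (simp add: h_u)
    finally show ?thesis
      using pq by (simp add: field_simps)
  qed
  obtain a b where ab: "(\<lambda>i. u (int i)) sums a" "(\<lambda>i. u (- int (Suc i))) sums b"
    and L: "pq_laplace p q (\<lambda>t. g (p * t)) s = (p - q) * (a + b)"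
    using ex unfolding u_def t_def pq_laplace_def pq_laplace_exists_def
    by (rule pq_integrable_sumsE)
  have "(\<lambda>i. h (int i)) \<longlonglongrightarrow> g 0"
  proof -
    have "(\<lambda>i. p * t (int i)) \<longlonglongrightarrow> 0"
      using pq by (simp add: t_def pq_node_of_nat LIMSEQ_power_zero)
    moreover have "isCont (\<lambda>x. g x * pq_Exp p q (- (x * s))) 0"
      by (intro continuous_intros cont isCont_o2[OF _ isCont_pq_Exp[OF pq]])
    ultimately have "(\<lambda>i. g (p * t (int i)) * pq_Exp p q (- (p * t (int i) * s)))
        \<longlonglongrightarrow> g 0 * pq_Exp p q (- (0 * s))"
      using isCont_tendsto_compose by blast
    then show ?thesis
      by (simp add: h_def pq_Exp_0)
  qed
  from telescope_sums'[OF this]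
  have head: "(\<lambda>i. h (int i) - h (int i + 1)) sums (h 0 - g 0)"
    by (simp add: add.commute)
  \<comment> \<open>Both \<open>u\<close> and \<open>1 / t\<close> tend to 0 in this direction,
    hence so do both terms of \<open>h_u\<close>. The negative half starts at index -1, but its
    telescoping sum ends at \<open>h 0\<close>.\<close>
  have "(\<lambda>i. h (- int i)) \<longlonglongrightarrow> 0"
  proof -
    have u0: "(\<lambda>i. u (- int (Suc i))) \<longlonglongrightarrow> 0"
      using ab(2) by (intro summable_LIMSEQ_zero) (rule sums_summable)
    have "(\<lambda>i. inverse (t (- int (Suc i)))) \<longlonglongrightarrow> 0"
    proof -
      have "(\<lambda>i. p * (q / p) ^ Suc i) \<longlonglongrightarrow> p * 0"
        using pq by (intro tendsto_intros LIMSEQ_Suc LIMSEQ_power_zero) auto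
      then show ?thesis
        using pq unfolding t_def pq_node_minus_of_nat[OF pq] by (simp add: field_simps power_divide)
    qed
    from tendsto_diff[OF tendsto_mult[OF u0 this] tendsto_mult_left[OF u0, of "(p - q) * s"]]
    have "(\<lambda>i. h (- int (Suc i))) \<longlonglongrightarrow> 0"
      unfolding h_u by (simp add: divide_inverse)
    then show ?thesis
      by (rule LIMSEQ_imp_Suc)
  qed
  from telescope_sums[OF this]
  have tail: "(\<lambda>i. h (- int (Suc i)) - h (- int (Suc i) + 1)) sums (0 - h 0)"
    by simp
  have "(\<lambda>i. v (int i)) sums ((h 0 - g 0) / (p - q) + s * a)"
    unfolding v_eq by (intro sums_add sums_mult sums_divide head ab)
  moreover have "(\<lambda>i. v (- int (Suc i))) sums ((0 - h 0) / (p - q) + s * b)"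
    unfolding v_eq by (intro sums_add sums_mult sums_divide tail ab)
  ultimately have
    "pq_laplace_exists p q (pq_deriv p q g) s"
    "pq_laplace p q (pq_deriv p q g) s =
      (p - q) * (((h 0 - g 0) / (p - q) + s * a) + ((0 - h 0) / (p - q) + s * b))"
    unfolding v_def t_def pq_laplace_exists_def pq_laplace_def
    by (rule pq_integral_sumsI)+
  \<comment> \<open>The boundary values \<open>h 0\<close> of the two halves cancel.\<close>
  moreover have "(p - q) * ((h 0 - g 0) / (p - q) + s * a + ((0 - h 0) / (p - q) + s * b)) =
      s * ((p - q) * (a + b)) - g 0"
    using pq by (simp add: distrib_left right_diff_distrib diff_divide_distrib)
  ultimately show "pq_laplace_exists p q (pq_deriv p q g) s"
    and "pq_laplace p q (pq_deriv p q g) s = s * pq_laplace p q (\<lambda>t. g (p * t)) s - g 0"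
    by (simp_all only: L)
qed

section \<open>Dilations and iterated derivatives\<close>

lemma pq_laplace_cmult:
  assumes "pq_laplace_exists p q f s"
  shows "pq_laplace_exists p q (\<lambda>t. c * f t) s"
    and "pq_laplace p q (\<lambda>t. c * f t) s = c * pq_laplace p q f s"
proof -
  obtain a b where
    ab: "(\<lambda>i. pq_node p q (int i) * (f (pq_node p q (int i)) *
        pq_Exp p q (- q * pq_node p q (int i) * s))) sums a"
      "(\<lambda>i. pq_node p q (- int (Suc i)) * (f (pq_node p q (- int (Suc i))) *
        pq_Exp p q (- q * pq_node p q (- int (Suc i)) * s))) sums b"
    and L: "pq_laplace p q f s = (p - q) * (a + b)"
    using assms unfolding pq_laplace_def pq_laplace_exists_def
    by (rule pq_integrable_sumsE)
  have
    "pq_laplace_exists p q (\<lambda>t. c * f t) s"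
    "pq_laplace p q (\<lambda>t. c * f t) s = (p - q) * (c * a + c * b)"
    unfolding pq_laplace_exists_def pq_laplace_def
    using sums_mult[OF ab(1), of c] sums_mult[OF ab(2), of c]
    by (auto intro!: pq_integral_sumsI simp: ac_simps)
  then show "pq_laplace_exists p q (\<lambda>t. c * f t) s"
    and "pq_laplace p q (\<lambda>t. c * f t) s = c * pq_laplace p q f s"
    by (auto simp: L algebra_simps)
qed

lemma deriv_scale:
  fixes g :: "real \<Rightarrow> real"
  assumes "g differentiable (at 0)"
  shows "deriv (\<lambda>t. c * g (p * t)) 0 = c * p * deriv g 0"
proof -
  have "(g has_field_derivative deriv g 0) (at (p * 0))"
    using assms by (simp add: DERIV_deriv_iff_real_differentiable)
  then have "((\<lambda>t. c * g (p * t)) has_field_derivative c * (deriv g 0 * p)) (at 0)"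
    by (auto intro!: derivative_eq_intros DERIV_chain2[where f = g])
  then show ?thesis
    by (simp add: DERIV_imp_deriv)
qed

text \<open>Each derivative contributes one factor \<open>p\<close>: from the difference quotient at
  \<open>x \<noteq> 0\<close>, and from the chain rule at 0, where differentiability of the iterates
  enters.\<close>

lemma funpow_pq_deriv_scale:
  assumes "p \<noteq> 0"
    and "\<And>k. k < n \<Longrightarrow> (pq_deriv p q ^^ k) f differentiable (at 0)"
  shows "(pq_deriv p q ^^ n) (\<lambda>t. f (p * t)) = (\<lambda>t. p ^ n * (pq_deriv p q ^^ n) f (p * t))"
  using assms(2)
proof (induction n)
  case (Suc n)
  define g where "g = (pq_deriv p q ^^ n) f"
  have IH: "(pq_deriv p q ^^ n) (\<lambda>t. f (p * t)) = (\<lambda>t. p ^ n * g (p * t))"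
    unfolding g_def using Suc by simp
  have "g differentiable (at 0)"
    unfolding g_def using Suc.prems by simp
  then have "pq_deriv p q (\<lambda>t. p ^ n * g (p * t)) x = p ^ Suc n * pq_deriv p q g (p * x)" for x
    using assms(1)
    by (cases "x = 0")
      (simp_all add: pq_deriv_def deriv_scale mult.left_commute flip: right_diff_distrib)
  then show ?case
    by (simp add: IH g_def fun_eq_iff)
qed simp

text \<open>Keeping the dilated function \<open>f (p ^ n * t)\<close> avoids any substitution in the
  integral. The induction varies \<open>f\<close>, because its step applies the hypothesis to
  \<open>f (p * t)\<close>.\<close>

lemma pq_laplace_funpow_pq_deriv:
  assumes pq: "0 < q" "q < p"
    and "\<And>k. k < n \<Longrightarrow> (pq_deriv p q ^^ k) f differentiable (at 0)"
    and "pq_laplace_exists p q (\<lambda>t. f (p ^ n * t)) s"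
  shows "pq_laplace_exists p q ((pq_deriv p q ^^ n) f) s \<and>
    pq_laplace p q ((pq_deriv p q ^^ n) f) s =
      s ^ n / p ^ (n choose 2) * pq_laplace p q (\<lambda>t. f (p ^ n * t)) s
      - (\<Sum>k<n. s ^ (n - 1 - k) / p ^ ((n - k) choose 2) * (pq_deriv p q ^^ k) f 0)"
  using assms(3-)
proof (induction n arbitrary: f)
  case 0
  then show ?case by (simp add: numeral_2_eq_2)
next
  case (Suc n)
  have p0: "p > 0" using pq by simp
  define F where "F = (\<lambda>t. f (p * t))"
  define g where "g = (pq_deriv p q ^^ n) f"
  have diff: "(pq_deriv p q ^^ k) f differentiable (at 0)" if "k \<le> n" for k
    using Suc.prems that by simp
  have F: "(pq_deriv p q ^^ k) F = (\<lambda>t. p ^ k * (pq_deriv p q ^^ k) f (p * t))" if "k \<le> n" for k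
    unfolding F_def using p0 diff that by (intro funpow_pq_deriv_scale) auto
  have scale: "(\<lambda>t. F (p ^ n * t)) = (\<lambda>t. f (p ^ Suc n * t))"
    by (simp add: F_def mult.assoc)
  have "(pq_deriv p q ^^ k) F differentiable (at 0)" if "k < n" for k
  proof -
    have "(\<lambda>t. (pq_deriv p q ^^ k) f (p * t)) differentiable (at 0)"
      using that diff[of k]
      by (intro differentiable_compose[where f = "(pq_deriv p q ^^ k) f" and g = "\<lambda>t. p * t"]) simp_all
    then show ?thesis
      using that by (simp add: F)
  qed
  then have IH: "pq_laplace_exists p q ((pq_deriv p q ^^ n) F) s"
    "pq_laplace p q ((pq_deriv p q ^^ n) F) s =
      s ^ n / p ^ (n choose 2) * pq_laplace p q (\<lambda>t. f (p ^ Suc n * t)) s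
      - (\<Sum>k<n. s ^ (n - 1 - k) / p ^ ((n - k) choose 2) * (pq_deriv p q ^^ k) F 0)"
    using Suc.IH[of F] Suc.prems(2) by (simp_all add: scale)
  \<comment> \<open>The factor \<open>1 / p ^ n\<close> raises the exponent
    \<open>n choose 2\<close> to \<open>Suc n choose 2\<close>.\<close>
  have g_F: "(\<lambda>t. g (p * t)) = (\<lambda>t. (1 / p ^ n) * (pq_deriv p q ^^ n) F t)"
    using p0 by (simp add: F g_def)
  have g_lap: "pq_laplace_exists p q (\<lambda>t. g (p * t)) s"
    "pq_laplace p q (\<lambda>t. g (p * t)) s = (1 / p ^ n) * pq_laplace p q ((pq_deriv p q ^^ n) F) s"
    unfolding g_F using pq_laplace_cmult[OF IH(1), of "1 / p ^ n"] by auto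
  have "isCont g 0"
    unfolding g_def using diff by (simp add: differentiable_imp_continuous_within)
  note Dg = pq_laplace_pq_deriv[OF pq this g_lap(1)]
  \<comment> \<open>The iterate of \<open>F\<close> at 0 carries \<open>p ^ k\<close>, so the
    exponent of \<open>p\<close> in the denominator grows by \<open>n - k\<close>.\<close>
  have summand: "s / p ^ n * (s ^ (n - 1 - k) / p ^ ((n - k) choose 2) * (pq_deriv p q ^^ k) F 0) =
      s ^ (n - k) / p ^ ((Suc n - k) choose 2) * (pq_deriv p q ^^ k) f 0" if "k < n" for k
  proof -
    from that obtain m where m: "n = k + Suc m"
      by (metis less_imp_Suc_add add_Suc_right)
    show ?thesis
      using p0 that by (simp add: F m choose_Suc_two power_add Suc_diff_le ac_simps)
  qed
  have "pq_laplace p q (pq_deriv p q g) s =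
      s ^ Suc n / p ^ (Suc n choose 2) * pq_laplace p q (\<lambda>t. f (p ^ Suc n * t)) s
      - s / p ^ n * (\<Sum>k<n. s ^ (n - 1 - k) / p ^ ((n - k) choose 2) * (pq_deriv p q ^^ k) F 0) - g 0"
    unfolding Dg(2) g_lap(2) IH(2)
    using p0 by (simp add: choose_Suc_two power_add right_diff_distrib ac_simps)
  also have "s / p ^ n * (\<Sum>k<n. s ^ (n - 1 - k) / p ^ ((n - k) choose 2) * (pq_deriv p q ^^ k) F 0) =
      (\<Sum>k<n. s ^ (n - k) / p ^ ((Suc n - k) choose 2) * (pq_deriv p q ^^ k) f 0)"
    unfolding sum_distrib_left by (intro sum.cong summand) auto
  \<comment> \<open>The term \<open>g 0\<close> is the summand for \<open>k = n\<close>, as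
    \<open>1 choose 2 = 0\<close>.\<close>
  finally show ?case
    using Dg(1) by (simp add: g_def numeral_2_eq_2)
qed

text \<open>The last assumption is the substitution rule for dilation by \<open>p ^ n\<close>, which
  need not preserve the nodes. Its factor \<open>1 / p ^ n\<close> turns \<open>n choose 2\<close>
  into \<open>(n + 1) choose 2\<close>.\<close>

theorem theorem3p11:
  fixes p q s :: real and n :: nat and f :: "real \<Rightarrow> real"
  assumes "0 < q" and "q < p" and "1 \<le> n" and "0 < s"
    and "\<And>k. k < n \<Longrightarrow> (pq_deriv p q ^^ k) f differentiable (at 0)"
    and "pq_laplace_exists p q f (s / p ^ n)"
    and "pq_laplace_exists p q (\<lambda>t. f (p ^ n * t)) s"
    and "pq_laplace p q (\<lambda>t. f (p ^ n * t)) s = pq_laplace p q f (s / p ^ n) / p ^ n"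
  shows "pq_laplace_exists p q ((pq_deriv p q ^^ n) f) s \<and>
    pq_laplace p q ((pq_deriv p q ^^ n) f) s =
      s ^ n / p ^ ((n + 1) choose 2) * pq_laplace p q f (s / p ^ n)
      - (\<Sum>k<n. s ^ (n - 1 - k) / p ^ ((n - k) choose 2) * (pq_deriv p q ^^ k) f 0)"
proof -
  have "s ^ n / p ^ (n choose 2) * pq_laplace p q (\<lambda>t. f (p ^ n * t)) s =
      s ^ n / p ^ ((n + 1) choose 2) * pq_laplace p q f (s / p ^ n)"
    by (simp add: assms(8) choose_Suc_two power_add)
  then show ?thesis
    using pq_laplace_funpow_pq_deriv[OF assms(1,2,5,7)] by simp
qed

end
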